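(* Let $S$ be a countable discrete set, $X=S^{\mathbb Z}$, $X^+=S^{\mathbb Z_+}$, and let $g\ge 0$ be a $g$-function (on $X^+$) such that $$\sum_{n=1}^{\infty}\left(\operatorname{svar}_n\sqrt g\right)^2<\infty .$$ Then any two distinct ergodic $g$-measures $\mu,\tilde\mu$ on $X$ are locally incomparable; that is, neither $\mu$ is locally absolutely continuous with respect to $\tilde\mu$, nor is $\tilde\mu$ locally absolutely continuous with respect to $\mu$.
   Context: $S$ is a countable set with the discrete topology; $\mathbb Z_+=\{0,1,2,\dots\}$. $X=S^{\mathbb Z}$ and $X^+=S^{\mathbb Z_+}$ carry the product topology and Borel $\sigma$-algebra. $T$ is the left shift on $X$, $(Tx)_i=x_{i+1}$ for $i\in\mathbb Z$. For $\sigma\in S$ and $y\in X^+$, $(\sigma,y)=(\sigma,y_0,y_1,\dots)\in X^+$. A $g$-function is a (nonnegative) Borel measurable function $g:X^+\to[0,1]$ with $\sum_{\sigma\in S}g(\sigma,y)=1$ for every $y\in X^+$; it is regarded as a function on $X$ via $g(x)=g(x_0,x_1,\dots)$. A $g$-measure is a $T$-invariant Borel probability measure $\mu$ on $X$ such that $g$ is the conditional probability of the coordinate $x_0$ given $x_1,x_2,\dots$, i.e. for every $\sigma\in S$, $\mu(x_0=\sigma\mid x_1,x_2,\dots)=g(\sigma,x_1,x_2,\dots)$ $\mu$-a.e.; equivalently $g(x)=\lim_n \mu[x_0,\dots,x_n]/\mu[x_1,\dots,x_n]$ for $\mu$-a.e. $x$. "Ergodic" means ergodic with respect to $T$. For $f:X^+\to\mathbb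 R$, $x\in X^+$ and $n\ge0$: $\operatorname{var}_n f(x)=\sup\{|f(x)-f(y)| : y\in X^+,\ y_i=x_i \text{ for } i\le n\}$, and $$\operatorname{svar}_n f=\sup_{x\in X^+}\Big(\sum_{\sigma\in S}\big(\operatorname{var}_{n+1}f(\sigma,x)\big)^2\Big)^{1/2}.$$ Local absolute continuity: let $\mathcal F_n^-$ be the $\sigma$-algebra on $X$ generated by the coordinates $x_{-n},x_{-n+1},\dots,x_{-1}$. A measure $\tilde\mu$ is locally absolutely continuous with respect to $\mu$ if $\tilde\mu|_{\mathcal F_n^-}\ll\mu|_{\mathcal F_n^-}$ for all $n$. (For $T$-invariant measures this says that every finite cylinder set of $\mu$-measure zero has $\tilde\mu$-measure zero.) *)

theory Defs
  imports "HOL-Probability.Probability"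
begin

text \<open>
  The alphabet \<open>S\<close> is a type \<open>'s\<close> of class \<^class>\<open>countable\<close> (finite or countably infinite)
  with the discrete topology; \<open>X = S\<^sup>\<int>\<close> is \<open>int \<Rightarrow> 's\<close> and \<open>X\<^sup>+\<close> is \<open>nat \<Rightarrow> 's\<close>.
\<close>

definition seq_borel :: "('i \<Rightarrow> 's) measure" where
  "seq_borel = sigma UNIV {U. openin (product_topology (\<lambda>_. discrete_topology UNIV) UNIV) U}"

lemma space_seq_borel [simp]: "space seq_borel = UNIV"
  by (simp add: seq_borel_def)

lemma sets_PiM_coord:
  "{x. x i \<in> A} \<in> sets (PiM (UNIV::'i set) (\<lambda>_. count_space (UNIV::'s set)))"
proof -
  have "(\<lambda>x. x i) -` A \<inter> space (PiM (UNIV::'i set) (\<lambda>_. count_space (UNIV::'s set)))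
      \<in> sets (PiM UNIV (\<lambda>_. count_space UNIV))"
    by (rule measurable_sets[OF measurable_component_singleton]) auto
  then show ?thesis by (simp add: space_PiM vimage_def)
qed

lemma sets_seq_borel [measurable_cong]:
  "sets (seq_borel :: ('i::countable \<Rightarrow> 's::countable) measure)
    = sets (PiM UNIV (\<lambda>_. count_space UNIV))"
proof -
  let ?T = "product_topology (\<lambda>_::'i. discrete_topology (UNIV::'s set)) UNIV"
  let ?P = "PiM UNIV (\<lambda>_::'i. count_space (UNIV::'s set))"
  define C where "C xs = {y :: 'i \<Rightarrow> 's. \<forall>p\<in>set xs. y (fst p) = snd p}" for xs
  have C: "C xs \<in> sets ?P" for xs
  proof -
    have "C xs = (\<Inter>p\<in>set xs. {y. y (fst p) \<in> {snd p}}) \<inter> space ?P"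
      by (auto simp: C_def space_PiM)
    also have "\<dots> \<in> sets ?P"
    proof (cases "set xs = {}")
      case False
      then show ?thesis
        by (intro sets.Int sets.finite_INT sets_PiM_coord sets.top) auto
    qed (simp only: Inter_empty image_empty Int_UNIV_left sets.top)
    finally show ?thesis .
  qed
  have open_P: "U \<in> sets ?P" if U: "openin ?T U" for U
  proof -
    have "x \<in> \<Union>(C ` {xs. C xs \<subseteq> U})" if "x \<in> U" for x
    proof -
      obtain V where V: "finite {i. V i \<noteq> topspace (discrete_topology (UNIV::'s set))}"
          "x \<in> Pi\<^sub>E UNIV V" "Pi\<^sub>E UNIV V \<subseteq> U"
        using U \<open>x \<in> U\<close> unfolding openin_product_topology_alt by fastforce
      obtain js where js: "set js = {i. V i \<noteq> UNIV}"
        using finite_list[OF V(1)] by auto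
      define xs where "xs = map (\<lambda>i. (i, x i)) js"
      have "x \<in> C xs"
        by (auto simp: C_def xs_def)
      moreover have "C xs \<subseteq> Pi\<^sub>E UNIV V"
      proof
        fix y assume y: "y \<in> C xs"
        have "y i \<in> V i" for i
        proof (cases "V i = UNIV")
          case False
          then have "y i = x i" using y js by (force simp: C_def xs_def)
          then show ?thesis using V(2) by (auto simp: PiE_iff)
        qed auto
        then show "y \<in> Pi\<^sub>E UNIV V" by (auto simp: PiE_iff)
      qed
      ultimately show ?thesis using V(3) by blast
    qed
    then have "U = \<Union>(C ` {xs. C xs \<subseteq> U})" by auto
    moreover have "\<Union>(C ` {xs. C xs \<subseteq> U}) \<in> sets ?P"
      using C by (intro sets.countable_UN') auto
    ultimately show ?thesis by simp
  qed
  have cyl: "openin ?T {f. f i \<in> A}" for i A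
  proof -
    have "openin ?T {f \<in> topspace ?T. f i \<in> A}"
      by (rule openin_continuous_map_preimage[OF continuous_map_product_projection]) auto
    then show ?thesis by simp
  qed
  have eq: "sets (seq_borel :: ('i \<Rightarrow> 's) measure) = sigma_sets UNIV {U. openin ?T U}"
    by (simp add: seq_borel_def)
  show ?thesis
  proof
    show "sets (seq_borel :: ('i \<Rightarrow> 's) measure) \<subseteq> sets ?P"
      unfolding eq using open_P sets.sigma_sets_subset[of "{U. openin ?T U}" ?P]
      by (auto simp: space_PiM)
    show "sets ?P \<subseteq> sets (seq_borel :: ('i \<Rightarrow> 's) measure)"
      unfolding sets_PiM_single eq using cyl by (auto intro!: sigma_sets_mono)
  qed
qed

definition shift :: "(int \<Rightarrow> 's) \<Rightarrow> int \<Rightarrow> 's" where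
  "shift x = (\<lambda>i. x (i + 1))"

lemma measurable_shift:
  "shift \<in> measurable (seq_borel :: (int \<Rightarrow> 's::countable) measure) seq_borel"
proof -
  have "shift \<in> measurable (PiM UNIV (\<lambda>_. count_space (UNIV::'s set))) (PiM UNIV (\<lambda>_. count_space UNIV))"
    by (rule measurable_PiM_single') (auto simp: shift_def space_PiM intro!: measurable_component_singleton)
  then show ?thesis
    by (simp cong: measurable_cong_sets add: sets_seq_borel)
qed

definition coord_algebra :: "int set \<Rightarrow> (int \<Rightarrow> 's) measure" where
  "coord_algebra I = sigma UNIV {{x. x i \<in> A} | i A. i \<in> I}"

lemma subalgebra_coord_algebra:
  fixes \<mu> :: "(int \<Rightarrow> 's::countable) measure"
  assumes "sets \<mu> = sets seq_borel"
  shows "subalgebra \<mu> (coord_algebra I)"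
proof -
  have sp: "space \<mu> = UNIV" using sets_eq_imp_space_eq[OF assms] by simp
  have "{x. x i \<in> A} \<in> sets \<mu>" for i A
    unfolding assms sets_seq_borel by (rule sets_PiM_coord)
  then have "sigma_sets UNIV {{x. x i \<in> A} | i A. i \<in> I} \<subseteq> sets \<mu>"
    using sets.sigma_sets_subset[of "{{x. x i \<in> A} | i A. i \<in> I}" \<mu>] sp by auto
  then show ?thesis
    by (simp add: subalgebra_def sp coord_algebra_def)
qed

text \<open>The concatenation \<open>(\<sigma>, y)\<close> is \<^term>\<open>case_nat \<sigma> y\<close>.\<close>

definition g_function :: "((nat \<Rightarrow> 's::countable) \<Rightarrow> real) \<Rightarrow> bool" where
  "g_function g \<longleftrightarrow>
     g \<in> borel_measurable seq_borel \<and>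
     (\<forall>x. 0 \<le> g x \<and> g x \<le> 1) \<and>
     (\<forall>y. ((\<lambda>\<sigma>. g (case_nat \<sigma> y)) has_sum 1) UNIV)"

definition g_measure :: "((nat \<Rightarrow> 's::countable) \<Rightarrow> real) \<Rightarrow> (int \<Rightarrow> 's) measure \<Rightarrow> bool" where
  "g_measure g \<mu> \<longleftrightarrow>
     prob_space \<mu> \<and> sets \<mu> = sets seq_borel \<and>
     distr \<mu> \<mu> shift = \<mu> \<and>
     (\<forall>\<sigma>. AE x in \<mu>.
        real_cond_exp \<mu> (coord_algebra {1..}) (indicator {x. x 0 = \<sigma>}) x
          = g (case_nat \<sigma> (\<lambda>n. x (int n + 1))))"

definition ergodic :: "(int \<Rightarrow> 's) measure \<Rightarrow> bool" where
  "ergodic \<mu> \<longleftrightarrow>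
     (\<forall>A\<in>sets \<mu>. shift -` A = A \<longrightarrow> measure \<mu> A = 0 \<or> measure \<mu> A = 1)"

text \<open>Variations take values in \<open>[0, \<infinity>]\<close>, since the suprema and the sum over \<open>S\<close> may be infinite.\<close>

definition var :: "nat \<Rightarrow> ((nat \<Rightarrow> 's) \<Rightarrow> real) \<Rightarrow> (nat \<Rightarrow> 's) \<Rightarrow> ennreal" where
  "var n f x = (SUP y\<in>{y. \<forall>i\<le>n. y i = x i}. ennreal \<bar>f x - f y\<bar>)"

definition ennreal_sqrt :: "ennreal \<Rightarrow> ennreal" where
  "ennreal_sqrt t = (if t = \<infinity> then \<infinity> else ennreal (sqrt (enn2real t)))"

definition svar :: "nat \<Rightarrow> ((nat \<Rightarrow> 's) \<Rightarrow> real) \<Rightarrow> ennreal" where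
  "svar n f = (SUP x. ennreal_sqrt (\<Sum>\<^sub>\<infinity>\<sigma>. (var (n + 1) f (case_nat \<sigma> x))\<^sup>2))"

text \<open>
  \<open>locally_ac \<nu> \<mu>\<close> says that \<open>\<nu>\<close> is locally absolutely continuous with respect to \<open>\<mu>\<close>. The library's
  \<^term>\<open>absolutely_continuous M N\<close> says that \<open>N\<close> is absolutely continuous with respect to \<open>M\<close>, hence the swapped arguments.
\<close>

definition locally_ac :: "(int \<Rightarrow> 's) measure \<Rightarrow> (int \<Rightarrow> 's) measure \<Rightarrow> bool" where
  "locally_ac \<nu> \<mu> \<longleftrightarrow>
     (\<forall>n::nat. absolutely_continuous
        (restr_to_subalg \<mu> (coord_algebra {- int n .. -1}))
        (restr_to_subalg \<nu> (coord_algebra {- int n .. -1})))"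

end

theory Submission
  imports Defs
begin

text \<open>
  Let \<open>P w\<close> and \<open>Q w\<close> be the probabilities of the word \<open>w\<close> under the two measures. If one measure is
  locally absolutely continuous with respect to the other, then for every length some word has
  \<open>P w > 0\<close> and \<open>Q w > 0\<close>. Starting from such a word, extend it to the left, letter by letter. Both
  measures draw the new letter from an average of the same function \<open>g\<close>, over futures that share the
  known word. The Hellinger distance of two such averages is at most the worst Hellinger distance of
  \<open>g (\<cdot>, u)\<close> and \<open>g (\<cdot>, v)\<close> over futures \<open>u\<close>, \<open>v\<close> that begin with the word, hence at most \<open>svar m (sqrt g)\<close>
  for a word of length \<open>m + 1\<close>. So one step of extension costs the affinity
  \<open>\<Sum>\<sigma>. sqrt (P (\<sigma> w) * Q (\<sigma> w))\<close> only a factor \<open>1 - h / 2\<close> with \<open>h = (svar m (sqrt g))\<^sup>2\<close>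
  (\<open>affinity_one_step\<close>). As the numbers \<open>h\<close> are summable, for a long initial word
  the affinity stays above half of its initial value for ever (\<open>affinity_lower_bound\<close>).

  On the other hand, distinct ergodic measures are mutually singular (\<open>ergodic_mutually_singular\<close>).
  The separating set can be approximated by a set \<open>C\<close> that depends on finitely many coordinates, and
  splitting the words according to \<open>C\<close> and its complement makes the affinity as small as desired, by
  the Cauchy--Schwarz inequality. This is a contradiction (\<open>g_measures_eq_if_common_word\<close>).
\<close>

section \<open>Distinct ergodic measures are mutually singular\<close>

text \<open>
  A Hahn set is a positive set of the signed measure \<open>M - N\<close> whose complement is negative. Such sets
  are not unique, and the proof of singularity needs the freedom to move them with the shift.
\<close>

definition hahn_set :: "'a measure \<Rightarrow> 'a measure \<Rightarrow> 'a set \<Rightarrow> bool" where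
  "hahn_set M N Y \<longleftrightarrow> Y \<in> sets M \<and>
     (\<forall>B\<in>sets M. B \<subseteq> Y \<longrightarrow> emeasure N B \<le> emeasure M B) \<and>
     (\<forall>B\<in>sets M. B \<inter> Y = {} \<longrightarrow> emeasure M B \<le> emeasure N B)"

lemma hahn_set_Compl:
  assumes "hahn_set M N Y" and eq: "sets N = sets M"
  shows "hahn_set N M (space M - Y)"
proof -
  have sub: "B \<subseteq> space M" if "B \<in> sets M" for B
    using sets.sets_into_space[OF that] .
  have "B \<subseteq> Y" if "B \<in> sets M" "B \<inter> (space M - Y) = {}" for B
    using sub[OF that(1)] that(2) by blast
  moreover have "B \<inter> Y = {}" if "B \<subseteq> space M - Y" for B
    using that by blast
  ultimately show ?thesis
    using assms unfolding hahn_set_def by (auto simp: eq)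
qed

text \<open>
  Cut a subset of the union into pieces, each in one of the sets, and add up.
\<close>

lemma hahn_set_UN:
  fixes Y :: "nat \<Rightarrow> 'a set"
  assumes Y: "\<And>n. hahn_set M N (Y n)" and eq: "sets N = sets M"
  shows "hahn_set M N (\<Union>n. Y n)"
proof -
  have [measurable]: "Y n \<in> sets M" for n
    using Y[of n] by (simp add: hahn_set_def)
  have "emeasure N B \<le> emeasure M B" if B[measurable]: "B \<in> sets M" and sub: "B \<subseteq> (\<Union>n. Y n)" for B
  proof -
    define D where "D n = B \<inter> disjointed Y n" for n
    have D[measurable]: "D n \<in> sets M" for n
      unfolding D_def disjointed_def by measurable
    have dis: "disjoint_family D"
      using disjoint_family_disjointed[of Y] by (auto simp: D_def disjoint_family_on_def)
    have un: "(\<Union>n. D n) = B"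
      using UN_disjointed_eq[of Y] sub by (auto simp: D_def)
    have "D n \<subseteq> Y n" for n
      using disjointed_subset[of Y n] by (auto simp: D_def)
    then have "emeasure N (D n) \<le> emeasure M (D n)" for n
      using Y[of n] D[of n] unfolding hahn_set_def by simp
    then have "(\<Sum>n. emeasure N (D n)) \<le> (\<Sum>n. emeasure M (D n))"
      by (intro suminf_le) auto
    moreover have "(\<Sum>n. emeasure N (D n)) = emeasure N (\<Union>n. D n)"
      by (rule suminf_emeasure) (auto simp: eq dis D)
    moreover have "(\<Sum>n. emeasure M (D n)) = emeasure M (\<Union>n. D n)"
      by (rule suminf_emeasure) (auto simp: dis D)
    ultimately show ?thesis unfolding un by simp
  qed
  moreover have "emeasure M B \<le> emeasure N B" if "B \<in> sets M" "B \<inter> (\<Union>n. Y n) = {}" for B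
  proof -
    have "B \<inter> Y 0 = {}" using that(2) by blast
    then show ?thesis using Y[of 0] that(1) by (auto simp: hahn_set_def)
  qed
  ultimately show ?thesis by (auto simp: hahn_set_def)
qed

lemma hahn_set_INT:
  fixes Y :: "nat \<Rightarrow> 'a set"
  assumes Y: "\<And>n. hahn_set M N (Y n)" and eq: "sets N = sets M"
  shows "hahn_set M N (\<Inter>n. Y n)"
proof -
  have sub: "Y n \<subseteq> space M" for n
    using Y[of n] by (auto simp: hahn_set_def dest: sets.sets_into_space)
  have "hahn_set N M (\<Union>n. space M - Y n)"
    by (intro hahn_set_UN hahn_set_Compl Y) (simp_all add: eq)
  then have "hahn_set M N (space N - (\<Union>n. space M - Y n))"
    by (rule hahn_set_Compl) (simp add: eq)
  also have "space N - (\<Union>n. space M - Y n) = (\<Inter>n. Y n)"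
    using sub[of 0] unfolding sets_eq_imp_space_eq[OF eq] by blast
  finally show ?thesis .
qed

text \<open>
  Invertibility of the shift is what makes preimages of Hahn sets Hahn sets: every measurable
  set is itself a preimage under the shift.
\<close>

definition unshift :: "(int \<Rightarrow> 's) \<Rightarrow> int \<Rightarrow> 's" where
  "unshift x = (\<lambda>i. x (i - 1))"

lemma shift_unshift [simp]: "shift (unshift x) = x" "unshift (shift x) = x"
  by (simp_all add: shift_def unshift_def)

lemma measurable_unshift:
  "unshift \<in> measurable (seq_borel :: (int \<Rightarrow> 's::countable) measure) seq_borel"
proof -
  have "unshift \<in> measurable (PiM UNIV (\<lambda>_. count_space (UNIV::'s set))) (PiM UNIV (\<lambda>_. count_space UNIV))"
    by (rule measurable_PiM_single') (auto simp: unshift_def space_PiM intro!: measurable_component_singleton)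
  then show ?thesis
    by (simp cong: measurable_cong_sets add: sets_seq_borel)
qed

locale shift_invariant = prob_space \<mu>
  for \<mu> :: "(int \<Rightarrow> 's::countable) measure" +
  assumes sets_borel [measurable_cong]: "sets \<mu> = sets seq_borel"
    and distr_shift: "distr \<mu> \<mu> shift = \<mu>"
begin

lemma space_UNIV [simp]: "space \<mu> = UNIV"
  using sets_eq_imp_space_eq[OF sets_borel] by simp

lemma shift_measurable [measurable]: "shift \<in> measurable \<mu> \<mu>"
  using measurable_shift by (simp cong: measurable_cong_sets add: sets_borel)

lemma vimage_shift_sets: "A \<in> sets \<mu> \<Longrightarrow> shift -` A \<in> sets \<mu>"
  using measurable_sets[OF shift_measurable, of A] by simp

lemma emeasure_vimage_shift:
  assumes "A \<in> sets \<mu>" shows "emeasure \<mu> (shift -` A) = emeasure \<mu> A"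
  using emeasure_distr[OF shift_measurable assms] by (simp add: distr_shift)

lemma vimage_funpow_shift:
  assumes "A \<in> sets \<mu>"
  shows "(shift ^^ n) -` A \<in> sets \<mu>" "emeasure \<mu> ((shift ^^ n) -` A) = emeasure \<mu> A"
proof -
  have "(shift ^^ n) -` A \<in> sets \<mu> \<and> emeasure \<mu> ((shift ^^ n) -` A) = emeasure \<mu> A"
  proof (induction n)
    case (Suc n)
    have "(shift ^^ Suc n) -` A = shift -` ((shift ^^ n) -` A)"
      by (auto simp: funpow_Suc_right simp del: funpow.simps)
    then show ?case
      using Suc vimage_shift_sets emeasure_vimage_shift by (simp del: funpow.simps)
  qed (use assms in simp)
  then show "(shift ^^ n) -` A \<in> sets \<mu>" "emeasure \<mu> ((shift ^^ n) -` A) = emeasure \<mu> A"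
    by auto
qed

end

lemma hahn_set_vimage_shift:
  assumes "shift_invariant \<mu>" "shift_invariant \<mu>'" "hahn_set \<mu> \<mu>' Y"
  shows "hahn_set \<mu> \<mu>' (shift -` Y)"
proof -
  interpret M: shift_invariant \<mu> by fact
  interpret N: shift_invariant \<mu>' by fact
  have img: "\<exists>C\<in>sets \<mu>. B = shift -` C \<and> (B \<subseteq> shift -` Y \<longrightarrow> C \<subseteq> Y) \<and> (B \<inter> shift -` Y = {} \<longrightarrow> C \<inter> Y = {})"
    if "B \<in> sets \<mu>" for B
  proof (intro bexI conjI impI)
    show "unshift -` B \<in> sets \<mu>"
      using measurable_sets[OF measurable_unshift, of B] that by (simp add: M.sets_borel)
    show "B = shift -` unshift -` B" by auto
    show "unshift -` B \<subseteq> Y" if "B \<subseteq> shift -` Y"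
      using that by (metis shift_unshift(1) subsetD subsetI vimage_eq)
    show "unshift -` B \<inter> Y = {}" if "B \<inter> shift -` Y = {}"
      using that by (metis disjoint_iff shift_unshift(1) vimage_eq)
  qed
  have meas: "emeasure \<mu> (shift -` C) = emeasure \<mu> C" "emeasure \<mu>' (shift -` C) = emeasure \<mu>' C"
    if "C \<in> sets \<mu>" for C
    using that M.emeasure_vimage_shift N.emeasure_vimage_shift by (auto simp: M.sets_borel N.sets_borel)
  show ?thesis
    unfolding hahn_set_def
  proof (intro conjI ballI impI)
    show "shift -` Y \<in> sets \<mu>"
      using assms(3) M.vimage_shift_sets by (simp add: hahn_set_def)
  next
    fix B assume B: "B \<in> sets \<mu>" "B \<subseteq> shift -` Y"
    then obtain C where "C \<in> sets \<mu>" "B = shift -` C" "C \<subseteq> Y" using img by meson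
    then show "emeasure \<mu>' B \<le> emeasure \<mu> B"
      using assms(3) meas by (simp add: hahn_set_def)
  next
    fix B assume B: "B \<in> sets \<mu>" "B \<inter> shift -` Y = {}"
    then obtain C where "C \<in> sets \<mu>" "B = shift -` C" "C \<inter> Y = {}" using img by meson
    then show "emeasure \<mu> B \<le> emeasure \<mu>' B"
      using assms(3) meas by (simp add: hahn_set_def)
  qed
qed

text \<open>
  All preimages of a Hahn set under iterates of the shift are Hahn sets, and Hahn sets are closed under
  countable unions and intersections. The upper limit of the preimages is therefore a Hahn set, and
  it is strictly invariant, since it only depends on the tail of the orbit.
\<close>

lemma invariant_hahn_set:
  assumes "shift_invariant \<mu>" "shift_invariant \<mu>'"
  obtains A where "hahn_set \<mu> \<mu>' A" "shift -` A = A"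
proof -
  interpret M: shift_invariant \<mu> by fact
  interpret N: shift_invariant \<mu>' by fact
  have eq: "sets \<mu>' = sets \<mu>" by (simp add: M.sets_borel N.sets_borel)
  obtain Y where Y: "hahn_set \<mu> \<mu>' Y"
    using finite_unsigned_Hahn_decomposition[OF M.finite_measure_axioms N.finite_measure_axioms eq]
    by (auto simp: hahn_set_def)
  have Yn: "hahn_set \<mu> \<mu>' ((shift ^^ n) -` Y)" for n
  proof (induction n)
    case (Suc n)
    have "(shift ^^ Suc n) -` Y = shift -` ((shift ^^ n) -` Y)"
      by (auto simp: funpow_Suc_right simp del: funpow.simps)
    with hahn_set_vimage_shift[OF assms Suc] show ?case by (simp del: funpow.simps)
  qed (use Y in simp)
  define A where "A = (\<Inter>m. \<Union>k. (shift ^^ (m + k)) -` Y)"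
  have "hahn_set \<mu> \<mu>' A"
    unfolding A_def by (intro hahn_set_INT hahn_set_UN Yn eq)
  moreover have "shift -` A = A"
  proof -
    have inA: "x \<in> A \<longleftrightarrow> (\<exists>\<^sub>\<infinity>n. (shift ^^ n) x \<in> Y)" for x
      unfolding A_def INFM_nat_le by (auto simp: le_iff_add)
    have "shift x \<in> A \<longleftrightarrow> (\<exists>\<^sub>\<infinity>n. (shift ^^ Suc n) x \<in> Y)" for x
      by (simp add: inA funpow_swap1)
    also have "\<dots> x \<longleftrightarrow> x \<in> A" for x
      unfolding inA frequently_def using eventually_sequentially_Suc[of "\<lambda>n. (shift ^^ n) x \<notin> Y"]
      by (simp add: cofinite_eq_sequentially)
    finally show ?thesis by auto
  qed
  ultimately show ?thesis using that by blast
qed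

text \<open>
  Apply the inequality also to the complement.
\<close>

lemma eq_if_emeasure_le:
  assumes "prob_space M" "prob_space N" and eq: "sets N = sets M"
    and le: "\<And>B. B \<in> sets M \<Longrightarrow> emeasure N B \<le> emeasure M B"
  shows "M = N"
proof (rule measure_eqI)
  fix B assume B: "B \<in> sets M"
  interpret M: prob_space M by fact
  interpret N: prob_space N by fact
  have "measure N B \<le> measure M B" "measure N (space M - B) \<le> measure M (space M - B)"
    using le[of B] le[of "space M - B"] B by (auto simp: M.emeasure_eq_measure N.emeasure_eq_measure)
  then have "measure M B = measure N B"
    using M.prob_compl[OF B] N.prob_compl[of B] B eq sets_eq_imp_space_eq[OF eq] by auto
  then show "emeasure M B = emeasure N B"
    by (simp add: M.emeasure_eq_measure N.emeasure_eq_measure)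
qed (simp add: eq)

text \<open>
  An invariant Hahn set \<open>A\<close> has probability 0 or 1 under both measures. If the two values agreed, one of \<open>A\<close> and its
  complement would be null for both measures. One measure would then dominate the other on every set, so
  they would be equal. The values differ, and the larger one belongs to \<open>\<mu>\<close>, for which \<open>A\<close> is the positive set.
\<close>

lemma ergodic_mutually_singular:
  assumes "shift_invariant \<mu>" "shift_invariant \<mu>'" "ergodic \<mu>" "ergodic \<mu>'" "\<mu> \<noteq> \<mu>'"
  obtains A where "A \<in> sets \<mu>" "measure \<mu> A = 1" "measure \<mu>' A = 0"
proof -
  interpret M: shift_invariant \<mu> by fact
  interpret N: shift_invariant \<mu>' by fact
  have eq: "sets \<mu>' = sets \<mu>" by (simp add: M.sets_borel N.sets_borel)
  obtain A where A: "hahn_set \<mu> \<mu>' A" "shift -` A = A"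
    using invariant_hahn_set[OF assms(1,2)] .
  have A_sets[measurable]: "A \<in> sets \<mu>" "A \<in> sets \<mu>'"
    using A(1) by (simp_all add: hahn_set_def eq)
  have zo: "measure \<mu> A = 0 \<or> measure \<mu> A = 1" "measure \<mu>' A = 0 \<or> measure \<mu>' A = 1"
    using assms(3,4) A_sets A(2) by (simp_all add: ergodic_def)
  have le: "emeasure \<mu>' (B \<inter> A) \<le> emeasure \<mu> (B \<inter> A)" "emeasure \<mu> (B - A) \<le> emeasure \<mu>' (B - A)"
    if "B \<in> sets \<mu>" for B
  proof -
    have "B \<inter> A \<in> sets \<mu>" "B - A \<in> sets \<mu>" "(B - A) \<inter> A = {}" using that A_sets by auto
    then show "emeasure \<mu>' (B \<inter> A) \<le> emeasure \<mu> (B \<inter> A)" "emeasure \<mu> (B - A) \<le> emeasure \<mu>' (B - A)"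
      using A(1) by (simp_all add: hahn_set_def)
  qed
  have part: "emeasure \<mu> B = emeasure \<mu> (B \<inter> A) + emeasure \<mu> (B - A)"
             "emeasure \<mu>' B = emeasure \<mu>' (B \<inter> A) + emeasure \<mu>' (B - A)" if [measurable]: "B \<in> sets \<mu>" for B
    using plus_emeasure[of "B \<inter> A" \<mu> "B - A"] plus_emeasure[of "B \<inter> A" \<mu>' "B - A"] A_sets that
    by (simp_all add: eq Int_Diff_Un Int_Diff_disjoint)
  have "\<not> (measure \<mu> A = 1 \<and> measure \<mu>' A = 1)"
  proof
    assume one: "measure \<mu> A = 1 \<and> measure \<mu>' A = 1"
    have "emeasure \<mu>' B \<le> emeasure \<mu> B" if B: "B \<in> sets \<mu>" for B
    proof -
      have "emeasure \<mu>' (B - A) \<le> emeasure \<mu>' (UNIV - A)"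
        by (intro emeasure_mono) (use A_sets in \<open>auto simp: sets.compl_sets[of _ \<mu>', simplified]\<close>)
      also have "\<dots> = 0"
        using N.prob_compl[OF A_sets(2)] one by (simp add: N.emeasure_eq_measure)
      finally show ?thesis using part[OF B] le(1)[OF B] by (simp add: add_increasing2)
    qed
    then show False
      using eq_if_emeasure_le[OF M.prob_space_axioms N.prob_space_axioms eq] assms(5) by blast
  qed
  moreover have "\<not> (measure \<mu> A = 0 \<and> measure \<mu>' A = 0)"
  proof
    assume zero: "measure \<mu> A = 0 \<and> measure \<mu>' A = 0"
    have "emeasure \<mu> B \<le> emeasure \<mu>' B" if B: "B \<in> sets \<mu>" for B
    proof -
      have "emeasure \<mu> (B \<inter> A) \<le> emeasure \<mu> A"
        by (intro emeasure_mono) auto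
      also have "\<dots> = 0" using zero by (simp add: M.emeasure_eq_measure)
      finally show ?thesis using part[OF B] le(2)[OF B] by (simp add: add_increasing)
    qed
    then show False
      using eq_if_emeasure_le[OF N.prob_space_axioms M.prob_space_axioms eq[symmetric]] assms(5) eq by auto
  qed
  moreover have "measure \<mu>' A \<le> measure \<mu> A"
    using le(1)[OF A_sets(1)] by (simp add: M.emeasure_eq_measure N.emeasure_eq_measure)
  ultimately show ?thesis using that[of A] A_sets zo by linarith
qed

section \<open>Approximation by sets that depend on finitely many coordinates\<close>

text \<open>
  The sets that can be approximated form a \<open>\<sigma>\<close>-algebra. Both measures are treated at once, because the
  same approximating set has to serve for both.
\<close>

lemma finite_measure_approx_by_algebra:
  assumes fin: "finite_measure M" "finite_measure N"
    and G: "algebra \<Omega> G"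
    and sM: "sets M = sigma_sets \<Omega> G" and sN: "sets N = sigma_sets \<Omega> G"
    and A: "A \<in> sets M" and e: "0 < (e::real)"
  obtains C where "C \<in> G" "measure M (sym_diff A C) < e" "measure N (sym_diff A C) < e"
proof -
  interpret M: finite_measure M by fact
  interpret N: finite_measure N by fact
  interpret G: algebra \<Omega> G by fact
  have NM: "sets N = sets M" using sM sN by simp
  have sp: "space M = \<Omega>" using sM G.space_closed
    by (metis sets.sigma_sets_eq sets.top sigma_sets_top sets.sets_into_space sigma_sets_into_sp subset_antisym)
  have GM: "C \<in> sets M" if "C \<in> G" for C using that sM by auto
  define approx where "approx A \<longleftrightarrow>
      (\<forall>e>0. \<exists>C\<in>G. measure M (sym_diff A C) < e \<and> measure N (sym_diff A C) < e)" for A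
  \<comment> \<open>Finite and countable unions are handled by covering a symmetric difference with two small sets.\<close>
  have cover: "measure M X < a + b \<and> measure N X < a + b"
    if "X \<subseteq> Y \<union> Z" "Y \<in> sets M" "Z \<in> sets M"
      "measure M Y < a \<and> measure N Y < a" "measure M Z < b \<and> measure N Z < b" for X Y Z a b
  proof -
    have YZ: "Y \<union> Z \<in> sets M" using that(2,3) by (rule sets.Un)
    have "measure M X \<le> measure M (Y \<union> Z)" "measure N X \<le> measure N (Y \<union> Z)"
      using M.finite_measure_mono[OF that(1)] N.finite_measure_mono[OF that(1)] YZ NM by blast+
    moreover have "measure M (Y \<union> Z) \<le> measure M Y + measure M Z" "measure N (Y \<union> Z) \<le> measure N Y + measure N Z"
      using measure_Un_le[OF that(2,3)] measure_Un_le[of Y N Z] that(2,3) NM by simp_all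
    ultimately show ?thesis using that by linarith
  qed
  have un: "approx (A \<union> B)" if A: "A \<in> sets M" "approx A" and B: "B \<in> sets M" "approx B" for A B
    unfolding approx_def
  proof (intro allI impI)
    fix e :: real assume "e > 0"
    then have e2: "e/2 > 0" by simp
    obtain C where C: "C \<in> G" "measure M (sym_diff A C) < e/2 \<and> measure N (sym_diff A C) < e/2"
      using A(2) e2 unfolding approx_def by blast
    obtain D where D: "D \<in> G" "measure M (sym_diff B D) < e/2 \<and> measure N (sym_diff B D) < e/2"
      using B(2) e2 unfolding approx_def by blast
    have "measure M (sym_diff (A \<union> B) (C \<union> D)) < e/2 + e/2 \<and> measure N (sym_diff (A \<union> B) (C \<union> D)) < e/2 + e/2"
      by (rule cover[OF _ _ _ C(2) D(2)]) (use A B GM C D in auto)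
    then show "\<exists>E\<in>G. measure M (sym_diff (A \<union> B) E) < e \<and> measure N (sym_diff (A \<union> B) E) < e"
      using G.Un[OF C(1) D(1)] by (intro bexI[of _ "C \<union> D"]) auto
  qed
  have "approx A" if "A \<in> sigma_sets \<Omega> G" for A
    using that
  proof induction
    case (Basic a)
    then show ?case by (auto simp: approx_def intro!: bexI[of _ a])
  next
    case Empty
    then show ?case by (auto simp: approx_def intro!: bexI[of _ "{}"])
  next
    case (Compl a)
    have "a \<subseteq> \<Omega>" using Compl.hyps G.space_closed by (meson sigma_sets_into_sp)
    then have eq: "sym_diff (\<Omega> - a) (\<Omega> - C) = sym_diff a C" if "C \<in> G" for C
      using that G.space_closed by auto
    show ?case unfolding approx_def
    proof (intro allI impI)
      fix e :: real assume "e > 0"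
      then obtain C where C: "C \<in> G" "measure M (sym_diff a C) < e" "measure N (sym_diff a C) < e"
        using Compl.IH by (auto simp: approx_def)
      then show "\<exists>C\<in>G. measure M (sym_diff (\<Omega> - a) C) < e \<and> measure N (sym_diff (\<Omega> - a) C) < e"
        using eq by (intro bexI[of _ "\<Omega> - C"]) auto
    qed
  next
    case (Union a)
    have a: "a i \<in> sets M" for i using Union.hyps sM by simp
    define b where "b n = (\<Union>i\<le>n. a i)" for n
    have b: "b n \<in> sets M" for n unfolding b_def using a by auto
    have appr_b: "approx (b n)" for n
    proof (induction n)
      case (Suc n)
      have "b (Suc n) = b n \<union> a (Suc n)" by (auto simp: b_def atMost_Suc)
      then show ?case using un[OF b Suc a Union.IH] by simp
    qed (use Union.IH in \<open>simp add: b_def\<close>)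
    define r where "r n = (\<Union>i. a i) - b n" for n
    have r: "r n \<in> sets M" for n unfolding r_def using a b by auto
    have dec: "decseq r" by (auto simp: r_def b_def decseq_def intro: order_trans)
    have int: "(\<Inter>n. r n) = {}" by (auto simp: r_def b_def)
    have lim: "(\<lambda>n. measure M (r n)) \<longlonglongrightarrow> 0" "(\<lambda>n. measure N (r n)) \<longlonglongrightarrow> 0"
      using M.finite_Lim_measure_decseq[of r] N.finite_Lim_measure_decseq[of r] r dec int
      by (auto simp: NM image_subset_iff)
    show ?case unfolding approx_def
    proof (intro allI impI)
      fix e :: real assume "e > 0"
      then have e2: "e/2 > 0" by simp
      have "\<forall>\<^sub>F n in sequentially. measure M (r n) < e/2 \<and> measure N (r n) < e/2"
        using order_tendstoD(2)[OF lim(1) e2] order_tendstoD(2)[OF lim(2) e2] by eventually_elim auto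
      then obtain n where n: "measure M (r n) < e/2 \<and> measure N (r n) < e/2"
        by (auto simp: eventually_sequentially)
      obtain C where C: "C \<in> G" "measure M (sym_diff (b n) C) < e/2 \<and> measure N (sym_diff (b n) C) < e/2"
        using appr_b[of n] e2 unfolding approx_def by blast
      have "measure M (sym_diff (\<Union>i. a i) C) < e/2 + e/2 \<and> measure N (sym_diff (\<Union>i. a i) C) < e/2 + e/2"
      proof (rule cover[OF _ _ _ n C(2)])
        show "sym_diff (\<Union>i. a i) C \<subseteq> r n \<union> sym_diff (b n) C" by (auto simp: r_def b_def)
      qed (use r b GM[OF C(1)] in auto)
      then show "\<exists>C\<in>G. measure M (sym_diff (\<Union>i. a i) C) < e \<and> measure N (sym_diff (\<Union>i. a i) C) < e"
        using C(1) by (intro bexI[of _ C]) auto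
    qed
  qed
  then show ?thesis using A e sM that unfolding approx_def by blast
qed

text \<open>
  One implication suffices, because the roles of \<open>x\<close> and \<open>y\<close> can be exchanged.
\<close>

definition determined_by :: "int set \<Rightarrow> (int \<Rightarrow> 's) set \<Rightarrow> bool" where
  "determined_by I C \<longleftrightarrow> (\<forall>x y. (\<forall>i\<in>I. x i = y i) \<longrightarrow> x \<in> C \<longrightarrow> y \<in> C)"

lemma determined_by_mono: "determined_by I C \<Longrightarrow> I \<subseteq> J \<Longrightarrow> determined_by J C"
  unfolding determined_by_def by blast

lemma determined_by_Compl: "determined_by I C \<Longrightarrow> determined_by I (- C)"
  unfolding determined_by_def by (metis ComplD ComplI)

definition local_sets :: "(int \<Rightarrow> 's::countable) set set" where
  "local_sets = {C \<in> sets seq_borel. \<exists>n::nat. determined_by {- int n..<int n} C}"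

lemma algebra_local_sets: "algebra UNIV (local_sets :: (int \<Rightarrow> 's::countable) set set)"
  unfolding algebra_iff_Un
proof (intro conjI ballI)
  show "{} \<in> (local_sets :: (int \<Rightarrow> 's) set set)" by (auto simp: local_sets_def determined_by_def)
next
  fix C :: "(int \<Rightarrow> 's) set" assume C: "C \<in> local_sets"
  have "space seq_borel - C \<in> sets (seq_borel :: (int \<Rightarrow> 's) measure)"
    using C by (intro sets.compl_sets) (simp add: local_sets_def)
  then show "UNIV - C \<in> local_sets"
    using C determined_by_Compl[of _ C] by (auto simp: local_sets_def Compl_eq_Diff_UNIV)
next
  fix C D :: "(int \<Rightarrow> 's) set" assume C: "C \<in> local_sets" and D: "D \<in> local_sets"
  then obtain m n :: nat where mn: "determined_by {- int m..<int m} C" "determined_by {- int n..<int n} D"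
    by (auto simp: local_sets_def)
  then have "determined_by {- int (max m n)..<int (max m n)} C" "determined_by {- int (max m n)..<int (max m n)} D"
    by (auto elim!: determined_by_mono)
  then have "determined_by {- int (max m n)..<int (max m n)} (C \<union> D)"
    unfolding determined_by_def by blast
  then show "C \<union> D \<in> local_sets" using C D unfolding local_sets_def by blast
qed auto

lemma sets_seq_borel_local_sets:
  "sets (seq_borel :: (int \<Rightarrow> 's::countable) measure) = sigma_sets UNIV local_sets"
proof
  have "{x :: int \<Rightarrow> 's. x i \<in> A} \<in> local_sets" for i A
  proof -
    have "determined_by {i} {x :: int \<Rightarrow> 's. x i \<in> A}"
      by (auto simp: determined_by_def)
    then have "determined_by {- int (nat \<bar>i\<bar> + 1)..<int (nat \<bar>i\<bar> + 1)} {x :: int \<Rightarrow> 's. x i \<in> A}"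
      by (rule determined_by_mono) auto
    then show ?thesis
      unfolding local_sets_def by (auto simp: sets_seq_borel sets_PiM_coord simp del: of_nat_Suc of_nat_add)
  qed
  then show "sets (seq_borel :: (int \<Rightarrow> 's) measure) \<subseteq> sigma_sets UNIV local_sets"
    unfolding sets_seq_borel sets_PiM_single by (auto intro!: sigma_sets_mono)
  show "sigma_sets UNIV local_sets \<subseteq> sets (seq_borel :: (int \<Rightarrow> 's) measure)"
    using sets.sigma_sets_subset[of local_sets "seq_borel :: (int \<Rightarrow> 's) measure"]
    by (auto simp: local_sets_def)
qed

section \<open>Affinity of the conditional laws of one letter\<close>

text \<open>
  After one more letter in front, two futures that agree up to index \<open>m\<close> agree up to index \<open>m + 1\<close>.
  This is the index shift in the definition of \<^const>\<open>svar\<close>.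
\<close>

lemma finite_sum_sqdiff_le_svar:
  assumes "finite F" "\<And>i. i \<le> m \<Longrightarrow> u i = v i"
  shows "ennreal (\<Sum>\<sigma>\<in>F. (f (case_nat \<sigma> u) - f (case_nat \<sigma> v))\<^sup>2) \<le> (svar m f)\<^sup>2"
proof -
  let ?V = "\<lambda>\<sigma>. (var (m + 1) f (case_nat \<sigma> u))\<^sup>2"
  have "ennreal ((f (case_nat \<sigma> u) - f (case_nat \<sigma> v))\<^sup>2) \<le> ?V \<sigma>" for \<sigma>
  proof -
    have "ennreal \<bar>f (case_nat \<sigma> u) - f (case_nat \<sigma> v)\<bar> \<le> var (m + 1) f (case_nat \<sigma> u)"
      unfolding var_def by (rule SUP_upper) (use assms(2) in \<open>auto split: nat.split\<close>)
    then have "(ennreal \<bar>f (case_nat \<sigma> u) - f (case_nat \<sigma> v)\<bar>)\<^sup>2 \<le> ?V \<sigma>"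
      by (rule power_mono) simp
    then show ?thesis by (simp add: ennreal_power)
  qed
  then have "(\<Sum>\<sigma>\<in>F. ennreal ((f (case_nat \<sigma> u) - f (case_nat \<sigma> v))\<^sup>2)) \<le> (\<Sum>\<sigma>\<in>F. ?V \<sigma>)"
    by (intro sum_mono)
  then have "ennreal (\<Sum>\<sigma>\<in>F. (f (case_nat \<sigma> u) - f (case_nat \<sigma> v))\<^sup>2) \<le> (\<Sum>\<sigma>\<in>F. ?V \<sigma>)"
    by simp
  also have "\<dots> \<le> (\<Sum>\<^sub>\<infinity>\<sigma>. ?V \<sigma>)"
    by (subst nonneg_infsum_complete) (use assms(1) in \<open>auto intro: SUP_upper\<close>)
  also have "\<dots> = (ennreal_sqrt (\<Sum>\<^sub>\<infinity>\<sigma>. ?V \<sigma>))\<^sup>2"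
    by (auto simp: ennreal_sqrt_def ennreal_power less_top ennreal_top_mult power2_eq_square simp flip: ennreal_mult)
  also have "\<dots> \<le> (svar m f)\<^sup>2"
    unfolding svar_def by (intro power_mono SUP_upper) auto
  finally show ?thesis .
qed

text \<open>
  For probability vectors \<open>a\<close> and \<open>b\<close> the affinity and the Hellinger distance are related by
  \<open>2 * (\<Sum>\<sigma>. sqrt (a \<sigma>) * sqrt (b \<sigma>)) = 2 - (\<Sum>\<sigma>. (sqrt (a \<sigma>) - sqrt (b \<sigma>))\<^sup>2)\<close>. The last sum is at most \<open>h\<close>
  because all its finite partial sums are.
\<close>

lemma affinity_ge:
  fixes g :: "(nat \<Rightarrow> 's::countable) \<Rightarrow> real"
  assumes g: "g_function g" and agree: "\<And>i. i \<le> m \<Longrightarrow> u i = v i"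
    and h: "(svar m (\<lambda>x. sqrt (g x)))\<^sup>2 \<le> ennreal h" "0 \<le> h"
  shows "ennreal (1 - h / 2)
      \<le> (\<integral>\<^sup>+\<sigma>. ennreal (sqrt (g (case_nat \<sigma> u))) * ennreal (sqrt (g (case_nat \<sigma> v))) \<partial>count_space UNIV)"
proof -
  define a where "a \<sigma> = g (case_nat \<sigma> u)" for \<sigma>
  define b where "b \<sigma> = g (case_nat \<sigma> v)" for \<sigma>
  have nn: "0 \<le> a \<sigma>" "0 \<le> b \<sigma>" for \<sigma> using g by (auto simp: a_def b_def g_function_def)
  have hs: "(a has_sum 1) UNIV" "(b has_sum 1) UNIV"
    using g by (auto simp: a_def[abs_def] b_def[abs_def] g_function_def)
  have ab: "((\<lambda>\<sigma>. a \<sigma> + b \<sigma>) has_sum (1 + 1)) UNIV"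
    by (rule has_sum_add[OF hs])
  have cross: "2 * (sqrt (a \<sigma>) * sqrt (b \<sigma>)) = a \<sigma> + b \<sigma> - (sqrt (a \<sigma>) - sqrt (b \<sigma>))\<^sup>2" for \<sigma>
    using nn[of \<sigma>] by (simp add: power2_diff)
  have cross_le: "sqrt (a \<sigma>) * sqrt (b \<sigma>) \<le> a \<sigma> + b \<sigma>" for \<sigma>
    using cross[of \<sigma>] nn[of \<sigma>] zero_le_power2[of "sqrt (a \<sigma>) - sqrt (b \<sigma>)"] by linarith
  have summ: "(\<lambda>\<sigma>. sqrt (a \<sigma>) * sqrt (b \<sigma>)) summable_on UNIV"
    by (rule summable_on_comparison_test[OF has_sum_imp_summable[OF ab]]) (use nn cross_le in auto)
  define s where "s = (\<Sum>\<^sub>\<infinity>\<sigma>. sqrt (a \<sigma>) * sqrt (b \<sigma>))"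
  have "(\<Sum>\<^sub>\<infinity>\<sigma>. a \<sigma> + b \<sigma>) \<le> 2 * s + h"
  proof (rule infsum_le_finite_sums[OF has_sum_imp_summable[OF ab]])
    fix F :: "'s set" assume F: "finite F"
    have "ennreal (\<Sum>\<sigma>\<in>F. (sqrt (a \<sigma>) - sqrt (b \<sigma>))\<^sup>2) \<le> ennreal h"
      using order_trans[OF finite_sum_sqdiff_le_svar[where f="\<lambda>x. sqrt (g x)", OF F agree] h(1)]
      by (simp add: a_def b_def)
    then have "(\<Sum>\<sigma>\<in>F. (sqrt (a \<sigma>) - sqrt (b \<sigma>))\<^sup>2) \<le> h"
      using h(2) by simp
    moreover have "(\<Sum>\<sigma>\<in>F. sqrt (a \<sigma>) * sqrt (b \<sigma>)) \<le> s"
      unfolding s_def by (rule finite_sum_le_infsum[OF summ F]) (use nn in auto)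
    moreover have "2 * (\<Sum>\<sigma>\<in>F. sqrt (a \<sigma>) * sqrt (b \<sigma>)) = (\<Sum>\<sigma>\<in>F. a \<sigma> + b \<sigma>) - (\<Sum>\<sigma>\<in>F. (sqrt (a \<sigma>) - sqrt (b \<sigma>))\<^sup>2)"
      unfolding sum_distrib_left cross by (simp add: sum_subtractf)
    ultimately show "(\<Sum>\<sigma>\<in>F. a \<sigma> + b \<sigma>) \<le> 2 * s + h" by linarith
  qed
  then have "1 - h / 2 \<le> s" using infsumI[OF ab] by simp
  have abss: "Infinite_Set_Sum.abs_summable_on (\<lambda>\<sigma>. sqrt (a \<sigma>) * sqrt (b \<sigma>)) UNIV"
    unfolding abs_summable_equivalent[symmetric] summable_on_iff_abs_summable_on_real[symmetric]
    by (rule summ)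
  have "(\<integral>\<^sup>+\<sigma>. ennreal (sqrt (a \<sigma>) * sqrt (b \<sigma>)) \<partial>count_space UNIV) = ennreal s"
    unfolding s_def using nn abss
    by (subst nn_integral_conv_infsetsum) (auto simp: infsetsum_infsum)
  then show ?thesis
    using \<open>1 - h / 2 \<le> s\<close> nn by (simp add: a_def b_def ennreal_mult[symmetric] ennreal_leI)
qed

section \<open>Cylinder sets and the defining property of a g-measure\<close>

definition cyl :: "int \<Rightarrow> 's list \<Rightarrow> (int \<Rightarrow> 's) set" where
  "cyl a w = {x. \<forall>i<length w. x (a + int i) = w ! i}"

lemma cyl_Nil [simp]: "cyl a [] = UNIV"
  by (simp add: cyl_def)

lemma mem_cyl_Cons: "x \<in> cyl a (\<sigma> # w) \<longleftrightarrow> x a = \<sigma> \<and> x \<in> cyl (a + 1) w"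
proof -
  have "(\<forall>i<Suc (length w). x (a + int i) = (\<sigma> # w) ! i) \<longleftrightarrow>
      x (a + int 0) = \<sigma> \<and> (\<forall>i<length w. x (a + int (Suc i)) = w ! i)"
    by (subst All_less_Suc2) simp
  then show ?thesis by (simp add: cyl_def algebra_simps)
qed

lemma funpow_shift_apply: "(shift ^^ n) x i = x (i + int n)"
  by (induction n arbitrary: i) (simp_all add: shift_def algebra_simps)

lemma vimage_funpow_shift_cyl: "(shift ^^ n) -` cyl a w = cyl (a + int n) w"
  by (auto simp: cyl_def funpow_shift_apply algebra_simps)

lemma cyl_coord_algebra:
  assumes "{a..<a + int (length w)} \<subseteq> I"
  shows "cyl a w \<in> sets (coord_algebra I)"
  using assms
proof (induction w arbitrary: a)
  case Nil
  then show ?case using sets.top[of "coord_algebra I"] by (simp add: coord_algebra_def)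
next
  case (Cons \<sigma> w)
  have "{x. x a \<in> {\<sigma>}} \<in> sets (coord_algebra I)"
  proof -
    have "a \<in> I" using Cons.prems by auto
    then have "{x. x a \<in> {\<sigma>}} \<in> {{x. x i \<in> A} |i A. i \<in> I}" by blast
    then show ?thesis unfolding coord_algebra_def by (auto intro!: sigma_sets.Basic)
  qed
  moreover have "cyl (a + 1) w \<in> sets (coord_algebra I)"
    using Cons.prems by (intro Cons.IH) auto
  moreover have "cyl a (\<sigma> # w) = {x. x a \<in> {\<sigma>}} \<inter> cyl (a + 1) w"
    by (auto simp: mem_cyl_Cons)
  ultimately show ?case by (metis sets.Int)
qed

context shift_invariant
begin

lemma cyl_sets [measurable]: "cyl a w \<in> sets \<mu>"
  using cyl_coord_algebra[of a w UNIV] subalgebra_coord_algebra[OF sets_borel, of UNIV]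
  by (auto simp: subalgebra_def)

lemma emeasure_cyl_shift: "emeasure \<mu> (cyl (a + int n) w) = emeasure \<mu> (cyl a w)"
  using vimage_funpow_shift(2)[of "cyl a w" n] by (simp add: vimage_funpow_shift_cyl)

lemma emeasure_cyl_split:
  assumes [measurable]: "C \<in> sets \<mu>"
  shows "emeasure \<mu> (cyl (a + 1) w \<inter> C) = (\<integral>\<^sup>+\<sigma>. emeasure \<mu> (cyl a (\<sigma> # w) \<inter> C) \<partial>count_space UNIV)"
proof -
  have "cyl (a + 1) w \<inter> C = (\<Union>\<sigma>. cyl a (\<sigma> # w) \<inter> C)"
    by (auto simp: mem_cyl_Cons)
  moreover have "emeasure \<mu> (\<Union>\<sigma>. cyl a (\<sigma> # w) \<inter> C) = (\<integral>\<^sup>+\<sigma>. emeasure \<mu> (cyl a (\<sigma> # w) \<inter> C) \<partial>count_space UNIV)"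
    by (rule emeasure_UN_countable) (auto simp: disjoint_family_on_def mem_cyl_Cons)
  ultimately show ?thesis by simp
qed

end

lemma g_measure_shift_invariant:
  "g_measure g \<mu> \<Longrightarrow> shift_invariant \<mu>"
  by (auto simp: g_measure_def shift_invariant_def shift_invariant_axioms_def)

text \<open>
  The sequence \<open>(\<sigma>, x\<^sub>0, x\<^sub>1, \<dots>)\<close>. Conditioning on the coordinates from 1 on and then shifting turns the
  conditional probability of a letter into \<open>g\<close> at this sequence.
\<close>

definition cons_future :: "'s \<Rightarrow> (int \<Rightarrow> 's) \<Rightarrow> nat \<Rightarrow> 's" where
  "cons_future \<sigma> x = case_nat \<sigma> (\<lambda>n. x (int n))"

lemma measurable_cons_future:
  "cons_future \<sigma> \<in> measurable (seq_borel :: (int \<Rightarrow> 's::countable) measure) seq_borel"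
proof -
  have "cons_future \<sigma> \<in> measurable (PiM UNIV (\<lambda>_. count_space (UNIV::'s set))) (PiM UNIV (\<lambda>_. count_space UNIV))"
  proof (rule measurable_PiM_single')
    show "(\<lambda>x. cons_future \<sigma> x i) \<in> measurable (PiM UNIV (\<lambda>_. count_space (UNIV::'s set))) (count_space UNIV)" for i
      by (cases i) (auto simp: cons_future_def intro!: measurable_component_singleton)
  qed (auto simp: space_PiM)
  then show ?thesis
    by (simp cong: measurable_cong_sets add: sets_seq_borel)
qed

text \<open>
  This is the integrated form of the conditional probability: integrate it over the event that \<open>w\<close> is
  read from position 1 on, which belongs to the conditioning \<open>\<sigma>\<close>-algebra, and shift.
\<close>

lemma emeasure_cyl_Cons:
  fixes g :: "(nat \<Rightarrow> 's::countable) \<Rightarrow> real"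
  assumes g: "g_function g" and \<mu>: "g_measure g \<mu>"
  shows "emeasure \<mu> (cyl 0 (\<sigma> # w)) = (\<integral>\<^sup>+x\<in>cyl 0 w. ennreal (g (cons_future \<sigma> x)) \<partial>\<mu>)"
proof -
  interpret shift_invariant \<mu> using g_measure_shift_invariant[OF \<mu>] .
  let ?F = "coord_algebra {1..} :: (int \<Rightarrow> 's) measure"
  interpret F: finite_measure_subalgebra \<mu> ?F
    by unfold_locales (rule subalgebra_coord_algebra[OF sets_borel])
  have [measurable]: "g \<in> borel_measurable seq_borel" and nn: "0 \<le> g x" and le1: "g x \<le> 1" for x
    using g by (auto simp: g_function_def)
  have [measurable]: "(\<lambda>x. g (cons_future \<sigma> x)) \<in> borel_measurable \<mu>"
    using measurable_compose[OF measurable_cons_future \<open>g \<in> borel_measurable seq_borel\<close>]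
    by (simp cong: measurable_cong_sets add: sets_borel)
  have [measurable]: "{x. x 0 = \<sigma>} \<in> sets \<mu>"
    using cyl_sets[of 0 "[\<sigma>]"] by (simp add: cyl_def)
  have B: "cyl 1 w \<in> sets ?F"
    by (rule cyl_coord_algebra) auto
  have int_G: "integrable \<mu> (\<lambda>x. indicator (cyl 0 w) x * g (cons_future \<sigma> x))"
    by (rule integrable_const_bound[of _ 1]) (use nn le1 in \<open>auto split: split_indicator\<close>)
  have "measure \<mu> (cyl 0 (\<sigma> # w)) = (\<integral>x\<in>cyl 1 w. indicator {x. x 0 = \<sigma>} x \<partial>\<mu>)"
  proof -
    have "cyl 0 (\<sigma> # w) = cyl 1 w \<inter> {x. x 0 = \<sigma>}" by (auto simp: mem_cyl_Cons)
    then show ?thesis by (simp add: set_lebesgue_integral_def indicator_inter_arith[symmetric])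
  qed
  also have "\<dots> = (\<integral>x\<in>cyl 1 w. real_cond_exp \<mu> ?F (indicator {x. x 0 = \<sigma>}) x \<partial>\<mu>)"
    by (rule F.real_cond_exp_intA[OF _ B]) (auto intro!: integrable_real_indicator simp: less_top[symmetric])
  also have "\<dots> = (\<integral>x. indicator (cyl 0 w) (shift x) * g (cons_future \<sigma> (shift x)) \<partial>\<mu>)"
    unfolding set_lebesgue_integral_def
  proof (rule integral_cong_AE)
    show "AE x in \<mu>. indicator (cyl 1 w) x *\<^sub>R real_cond_exp \<mu> ?F (indicator {x. x 0 = \<sigma>}) x
        = indicator (cyl 0 w) (shift x) * g (cons_future \<sigma> (shift x))"
      using \<mu>[unfolded g_measure_def, THEN conjunct2, THEN conjunct2, THEN conjunct2, rule_format, of \<sigma>]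
    proof eventually_elim
      case (elim x)
      have "indicator (cyl 1 w) x = (indicator (cyl 0 w) (shift x) :: real)"
        by (auto simp: indicator_def cyl_def shift_def add.commute)
      then show ?case using elim by (simp add: cons_future_def shift_def)
    qed
  qed auto
  also have "\<dots> = (\<integral>x. indicator (cyl 0 w) x * g (cons_future \<sigma> x) \<partial>distr \<mu> \<mu> shift)"
    by (rule integral_distr[symmetric]) auto
  also have "\<dots> = (\<integral>x. indicator (cyl 0 w) x * g (cons_future \<sigma> x) \<partial>\<mu>)"
    by (simp add: distr_shift)
  finally have "emeasure \<mu> (cyl 0 (\<sigma> # w)) = ennreal (\<integral>x. indicator (cyl 0 w) x * g (cons_future \<sigma> x) \<partial>\<mu>)"
    by (simp add: emeasure_eq_measure)
  also have "\<dots> = (\<integral>\<^sup>+x. ennreal (indicator (cyl 0 w) x * g (cons_future \<sigma> x)) \<partial>\<mu>)"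
    by (rule nn_integral_eq_integral[symmetric, OF int_G]) (use nn in auto)
  also have "\<dots> = (\<integral>\<^sup>+x\<in>cyl 0 w. ennreal (g (cons_future \<sigma> x)) \<partial>\<mu>)"
    by (intro nn_integral_cong) (auto split: split_indicator)
  finally show ?thesis .
qed

lemma ennreal_power2_le_imp_le:
  fixes a b :: ennreal
  assumes "a\<^sup>2 \<le> b\<^sup>2" shows "a \<le> b"
proof (cases "b = top")
  case b: False
  have "a \<noteq> top"
  proof
    assume "a = top"
    then have "b * b = top" using assms by (simp add: power2_eq_square ennreal_top_mult top_unique)
    then show False using b by (simp add: ennreal_mult_eq_top_iff)
  qed
  then obtain x where x: "0 \<le> x" "a = ennreal x" by (cases a) auto
  obtain y where y: "0 \<le> y" "b = ennreal y" using b by (cases b) auto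
  have "x\<^sup>2 \<le> y\<^sup>2" using assms x y by (simp add: ennreal_power)
  then show ?thesis using x y power2_le_imp_le ennreal_leI by blast
qed simp

text \<open>
  Jensen's inequality for the square root on \<open>B\<close>, without normalising by the measure of \<open>B\<close>.
\<close>

lemma nn_integral_sqrt_le:
  assumes [measurable]: "f \<in> borel_measurable M" "B \<in> sets M" and nn: "\<And>x. 0 \<le> f x"
    and p: "emeasure M B = ennreal p" "0 \<le> p" and q: "(\<integral>\<^sup>+x\<in>B. ennreal (f x) \<partial>M) = ennreal q" "0 \<le> q"
  shows "(\<integral>\<^sup>+x\<in>B. ennreal (sqrt (f x)) \<partial>M) \<le> ennreal (sqrt (p * q))"
proof -
  let ?I = "\<integral>\<^sup>+x\<in>B. ennreal (sqrt (f x)) \<partial>M"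
  have indicator_squared: "(indicator B x)\<^sup>2 = (indicator B x :: ennreal)" for x
    by (simp split: split_indicator)
  have "?I\<^sup>2 = (\<integral>\<^sup>+x. indicator B x * (ennreal (sqrt (f x)) * indicator B x) \<partial>M)\<^sup>2"
    by (intro arg_cong[of _ _ "\<lambda>t. t\<^sup>2"] nn_integral_cong) (auto split: split_indicator)
  also have "\<dots> \<le> (\<integral>\<^sup>+x. (indicator B x)\<^sup>2 \<partial>M) * (\<integral>\<^sup>+x. (ennreal (sqrt (f x)) * indicator B x)\<^sup>2 \<partial>M)"
    by (rule Cauchy_Schwarz_nn_integral) auto
  also have "(\<integral>\<^sup>+x. (indicator B x)\<^sup>2 \<partial>M) = emeasure M B"
    by (simp add: indicator_squared)
  also have "(\<integral>\<^sup>+x. (ennreal (sqrt (f x)) * indicator B x)\<^sup>2 \<partial>M) = (\<integral>\<^sup>+x\<in>B. ennreal (f x) \<partial>M)"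
    by (intro nn_integral_cong) (auto split: split_indicator simp: ennreal_power nn)
  also have "emeasure M B * (\<integral>\<^sup>+x\<in>B. ennreal (f x) \<partial>M) = (ennreal (sqrt (p * q)))\<^sup>2"
    using p q by (simp add: ennreal_mult ennreal_power)
  finally show ?thesis by (rule ennreal_power2_le_imp_le)
qed


section \<open>Affinity along extensions to the left\<close>

text \<open>
  Averaging cannot lower the affinity. By Jensen's inequality the square root of an average is at
  least the average of the square roots, so it suffices to integrate the bound \<open>affinity_ge\<close> over all pairs of
  futures \<open>x\<close>, \<open>y\<close> that begin with \<open>w\<close>. Such futures agree up to index \<open>m\<close>.
\<close>

lemma affinity_one_step:
  fixes g :: "(nat \<Rightarrow> 's::countable) \<Rightarrow> real"
  assumes g: "g_function g" and \<mu>: "g_measure g \<mu>" and \<mu>': "g_measure g \<mu>'"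
    and w: "length w = Suc m"
    and h: "(svar m (\<lambda>x. sqrt (g x)))\<^sup>2 \<le> ennreal h" "0 \<le> h" "h \<le> 2"
  shows "ennreal ((1 - h / 2) * sqrt (measure \<mu> (cyl 0 w) * measure \<mu>' (cyl 0 w)))
    \<le> (\<integral>\<^sup>+\<sigma>. ennreal (sqrt (measure \<mu> (cyl 0 (\<sigma> # w)) * measure \<mu>' (cyl 0 (\<sigma> # w)))) \<partial>count_space UNIV)"
    (is "_ \<le> ?S")
proof -
  interpret M: shift_invariant \<mu> using g_measure_shift_invariant[OF \<mu>] .
  interpret N: shift_invariant \<mu>' using g_measure_shift_invariant[OF \<mu>'] .
  let ?W = "cyl 0 w"
  define P where "P = measure \<mu> ?W"
  define Q where "Q = measure \<mu>' ?W"
  define p where "p \<sigma> = measure \<mu> (cyl 0 (\<sigma> # w))" for \<sigma>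
  define q where "q \<sigma> = measure \<mu>' (cyl 0 (\<sigma> # w))" for \<sigma>
  define c where "c = ennreal (1 - h / 2)"
  let ?a = "\<lambda>\<sigma> x. ennreal (sqrt (g (cons_future \<sigma> x)))"
  have nn: "0 \<le> g x" for x using g by (auto simp: g_function_def)
  have gm: "g \<in> borel_measurable seq_borel" using g by (auto simp: g_function_def)
  have [measurable]: "(\<lambda>x. g (cons_future \<sigma> x)) \<in> borel_measurable \<mu>" "(\<lambda>x. g (cons_future \<sigma> x)) \<in> borel_measurable \<mu>'" for \<sigma>
    using measurable_compose[OF measurable_cons_future gm]
    by (simp_all cong: measurable_cong_sets add: M.sets_borel N.sets_borel)
  have A: "(\<integral>\<^sup>+x\<in>?W. ?a \<sigma> x \<partial>\<mu>) \<le> ennreal (sqrt (P * p \<sigma>))" for \<sigma>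
    by (rule nn_integral_sqrt_le) (auto simp: nn P_def p_def M.emeasure_eq_measure emeasure_cyl_Cons[OF g \<mu>, symmetric])
  have B: "(\<integral>\<^sup>+x\<in>?W. ?a \<sigma> x \<partial>\<mu>') \<le> ennreal (sqrt (Q * q \<sigma>))" for \<sigma>
    by (rule nn_integral_sqrt_le) (auto simp: nn Q_def q_def N.emeasure_eq_measure emeasure_cyl_Cons[OF g \<mu>', symmetric])
  have ptw: "c * indicator ?W x * indicator ?W y
      \<le> (\<integral>\<^sup>+\<sigma>. (?a \<sigma> x * indicator ?W x) * (?a \<sigma> y * indicator ?W y) \<partial>count_space UNIV)" for x y
  proof (cases "x \<in> ?W \<and> y \<in> ?W")
    case True
    have agree: "x (int i) = y (int i)" if "i \<le> m" for i
      using True that w by (auto simp: cyl_def)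
    show ?thesis
      using affinity_ge[OF g agree h(1,2)] True by (simp add: c_def cons_future_def)
  qed auto
  have "c * ennreal (P * Q) = c * emeasure \<mu> ?W * emeasure \<mu>' ?W"
    by (simp add: P_def Q_def M.emeasure_eq_measure N.emeasure_eq_measure ennreal_mult mult.assoc)
  also have "\<dots> = (\<integral>\<^sup>+y. (\<integral>\<^sup>+x. c * indicator ?W x * indicator ?W y \<partial>\<mu>) \<partial>\<mu>')"
    by (simp add: nn_integral_multc nn_integral_cmult)
  also have "\<dots> \<le> (\<integral>\<^sup>+y. (\<integral>\<^sup>+x. (\<integral>\<^sup>+\<sigma>. (?a \<sigma> x * indicator ?W x) * (?a \<sigma> y * indicator ?W y) \<partial>count_space UNIV) \<partial>\<mu>) \<partial>\<mu>')"
    by (intro nn_integral_mono ptw)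
  also have "\<dots> = (\<integral>\<^sup>+y. (\<integral>\<^sup>+\<sigma>. (\<integral>\<^sup>+x\<in>?W. ?a \<sigma> x \<partial>\<mu>) * (?a \<sigma> y * indicator ?W y) \<partial>count_space UNIV) \<partial>\<mu>')"
    by (simp add: nn_integral_count_space_nn_integral nn_integral_multc)
  also have "\<dots> = (\<integral>\<^sup>+\<sigma>. (\<integral>\<^sup>+x\<in>?W. ?a \<sigma> x \<partial>\<mu>) * (\<integral>\<^sup>+y\<in>?W. ?a \<sigma> y \<partial>\<mu>') \<partial>count_space UNIV)"
    by (simp add: nn_integral_count_space_nn_integral nn_integral_cmult)
  also have "\<dots> \<le> (\<integral>\<^sup>+\<sigma>. ennreal (sqrt (P * p \<sigma>)) * ennreal (sqrt (Q * q \<sigma>)) \<partial>count_space UNIV)"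
    by (intro nn_integral_mono mult_mono A B) auto
  also have "\<dots> = (\<integral>\<^sup>+\<sigma>. ennreal (sqrt (P * Q)) * ennreal (sqrt (p \<sigma> * q \<sigma>)) \<partial>count_space UNIV)"
    by (intro nn_integral_cong) (simp add: ennreal_mult[symmetric] real_sqrt_mult P_def Q_def p_def q_def mult_ac)
  also have "\<dots> = ennreal (sqrt (P * Q)) * ?S"
    by (simp add: nn_integral_cmult p_def q_def)
  finally have *: "c * ennreal (P * Q) \<le> ennreal (sqrt (P * Q)) * ?S" .
  have PQ: "0 \<le> P * Q" by (simp add: P_def Q_def)
  show ?thesis
  proof (cases "P * Q = 0")
    case False
    have "ennreal (P * Q) = ennreal (sqrt (P * Q)) * ennreal (sqrt (P * Q))"
      using PQ by (simp add: ennreal_mult[symmetric])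
    then have "ennreal (sqrt (P * Q)) * (c * ennreal (sqrt (P * Q))) \<le> ennreal (sqrt (P * Q)) * ?S"
      using * by (simp add: mult_ac)
    then have "c * ennreal (sqrt (P * Q)) \<le> ?S"
      by (rule ennreal_mult_le_mult_iff[THEN iffD1, rotated 2]) (use False PQ in auto)
    then show ?thesis
      using h by (simp add: c_def P_def Q_def ennreal_mult)
  next
    case True
    then show ?thesis unfolding P_def Q_def by (simp only: real_sqrt_zero mult_zero_right ennreal_0 zero_le)
  qed
qed

text \<open>
  The Cauchy--Schwarz inequality for sums, in the form used to merge the cylinders of all words \<open>\<sigma> w\<close>.
\<close>

lemma nn_integral_count_space_sqrt_le:
  assumes nn: "\<And>\<sigma>. 0 \<le> p \<sigma>" "\<And>\<sigma>. 0 \<le> q \<sigma>" "0 \<le> P" "0 \<le> Q"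
    and P: "ennreal P = (\<integral>\<^sup>+\<sigma>. ennreal (p \<sigma>) \<partial>count_space UNIV)"
    and Q: "ennreal Q = (\<integral>\<^sup>+\<sigma>. ennreal (q \<sigma>) \<partial>count_space UNIV)"
  shows "(\<integral>\<^sup>+\<sigma>. ennreal (sqrt (p \<sigma> * q \<sigma>)) \<partial>count_space UNIV) \<le> ennreal (sqrt (P * Q))"
proof -
  have "(\<integral>\<^sup>+\<sigma>. ennreal (sqrt (p \<sigma> * q \<sigma>)) \<partial>count_space UNIV)\<^sup>2
      = (\<integral>\<^sup>+\<sigma>. ennreal (sqrt (p \<sigma>)) * ennreal (sqrt (q \<sigma>)) \<partial>count_space UNIV)\<^sup>2"
    using nn by (simp add: real_sqrt_mult ennreal_mult)
  also have "\<dots> \<le> (\<integral>\<^sup>+\<sigma>. (ennreal (sqrt (p \<sigma>)))\<^sup>2 \<partial>count_space UNIV) * (\<integral>\<^sup>+\<sigma>. (ennreal (sqrt (q \<sigma>)))\<^sup>2 \<partial>count_space UNIV)"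
    by (rule Cauchy_Schwarz_nn_integral) auto
  also have "\<dots> = ennreal P * ennreal Q"
    using nn by (simp add: ennreal_power P Q)
  also have "\<dots> = (ennreal (sqrt (P * Q)))\<^sup>2"
    using nn by (simp add: ennreal_mult[symmetric] ennreal_power)
  finally show ?thesis by (rule ennreal_power2_le_imp_le)
qed

definition affinity_on :: "'a measure \<Rightarrow> 'a measure \<Rightarrow> 'a set \<Rightarrow> real" where
  "affinity_on M N B = sqrt (measure M B * measure N B)"

text \<open>
  Summing the affinities of all words that end in \<open>w\<close> and have \<open>n\<close> more letters in front would show that
  the losses add up to at most \<open>\<Sum>j<n. h (k + j)\<close>. The induction avoids this sum over words: it compares the
  affinity of \<open>w\<close> directly with the affinities of the two parts of \<open>w\<close>, moved to position \<open>n\<close>, that \<open>C\<close> separates. The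
  induction hypothesis is applied to every word \<open>\<sigma> w\<close>, and the results are merged by Cauchy--Schwarz. For \<open>n = 0\<close>
  the set \<open>C\<close> only looks at coordinates that the word fixes, so one of the two parts is empty.
\<close>

lemma affinity_lower_bound:
  fixes g :: "(nat \<Rightarrow> 's::countable) \<Rightarrow> real" and h :: "nat \<Rightarrow> real"
  assumes g: "g_function g" and \<mu>: "g_measure g \<mu>" and \<mu>': "g_measure g \<mu>'"
    and h: "\<And>j. (svar (Suc j) (\<lambda>x. sqrt (g x)))\<^sup>2 \<le> ennreal (h j)" "\<And>j. 0 \<le> h j"
    and C: "C \<in> sets \<mu>" "determined_by {0..<int n + int (length w)} C"
    and w: "length w = k + 2" and small: "(\<Sum>j<n. h (k + j)) \<le> 2"
  shows "(1 - (\<Sum>j<n. h (k + j)) / 2) * affinity_on \<mu> \<mu>' (cyl 0 w)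
     \<le> affinity_on \<mu> \<mu>' (cyl (int n) w \<inter> C) + affinity_on \<mu> \<mu>' (cyl (int n) w \<inter> - C)"
  using C(2) w small
proof (induction n arbitrary: w k)
  case 0
  have "cyl 0 w \<subseteq> C \<or> cyl 0 w \<inter> C = {}"
  proof (rule ccontr)
    assume "\<not> ?thesis"
    then obtain x y where xy: "x \<in> cyl 0 w" "x \<notin> C" "y \<in> cyl 0 w" "y \<in> C" by blast
    have "y i = x i" if "i \<in> {0..<int (length w)}" for i
    proof -
      have i: "nat i < length w" "int (nat i) = i" using that by auto
      then have "y (0 + int (nat i)) = w ! nat i" "x (0 + int (nat i)) = w ! nat i"
        using xy(1,3) unfolding cyl_def by blast+
      then show ?thesis by (simp only: i add_0)
    qed
    moreover have "determined_by {0..<int (length w)} C" using 0(1) by simp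
    ultimately show False using xy(2,4) unfolding determined_by_def by blast
  qed
  then have "cyl 0 w \<inter> C = cyl 0 w \<and> cyl 0 w \<inter> - C = {} \<or> cyl 0 w \<inter> C = {} \<and> cyl 0 w \<inter> - C = cyl 0 w"
    by blast
  then show ?case by (auto simp: affinity_on_def)
next
  case (Suc n)
  interpret M: shift_invariant \<mu> using g_measure_shift_invariant[OF \<mu>] .
  interpret N: shift_invariant \<mu>' using g_measure_shift_invariant[OF \<mu>'] .
  define r where "r = (\<Sum>j<n. h (Suc k + j))"
  have sum_eq: "(\<Sum>j<Suc n. h (k + j)) = h k + r"
    unfolding r_def by (subst sum.lessThan_Suc_shift) simp
  have r: "0 \<le> r" unfolding r_def by (intro sum_nonneg h(2))
  have hk: "0 \<le> h k" "h k \<le> 2" "r \<le> 2"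
    using h(2)[of k] r Suc.prems(3) sum_eq by auto
  have CM: "C \<in> sets \<mu>" "- C \<in> sets \<mu>" "C \<in> sets \<mu>'" "- C \<in> sets \<mu>'"
    using C(1) sets.compl_sets[of C \<mu>] by (auto simp: M.sets_borel N.sets_borel Compl_eq_Diff_UNIV)
  have merge: "(\<integral>\<^sup>+\<sigma>. ennreal (affinity_on \<mu> \<mu>' (cyl (int n) (\<sigma> # w) \<inter> D)) \<partial>count_space UNIV)
      \<le> ennreal (affinity_on \<mu> \<mu>' (cyl (int (Suc n)) w \<inter> D))" if "D \<in> sets \<mu>" "D \<in> sets \<mu>'" for D
    unfolding affinity_on_def
    by (rule nn_integral_count_space_sqrt_le)
      (use M.emeasure_cyl_split[OF that(1), of "int n" w] N.emeasure_cyl_split[OF that(2), of "int n" w]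
        in \<open>simp_all add: M.emeasure_eq_measure N.emeasure_eq_measure add.commute\<close>)
  have "ennreal ((1 - r / 2) * ((1 - h k / 2) * affinity_on \<mu> \<mu>' (cyl 0 w)))
      = ennreal (1 - r / 2) * ennreal ((1 - h k / 2) * affinity_on \<mu> \<mu>' (cyl 0 w))"
    using hk by (intro ennreal_mult) (auto simp: affinity_on_def)
  also have "\<dots> \<le> ennreal (1 - r / 2) * (\<integral>\<^sup>+\<sigma>. ennreal (affinity_on \<mu> \<mu>' (cyl 0 (\<sigma> # w))) \<partial>count_space UNIV)"
    unfolding affinity_on_def
    by (intro mult_left_mono affinity_one_step[OF g \<mu> \<mu>' _ h(1)]) (use hk Suc.prems in auto)
  also have "\<dots> = (\<integral>\<^sup>+\<sigma>. ennreal ((1 - r / 2) * affinity_on \<mu> \<mu>' (cyl 0 (\<sigma> # w))) \<partial>count_space UNIV)"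
    using hk by (simp add: nn_integral_cmult[symmetric] ennreal_mult affinity_on_def)
  also have "\<dots> \<le> (\<integral>\<^sup>+\<sigma>. ennreal (affinity_on \<mu> \<mu>' (cyl (int n) (\<sigma> # w) \<inter> C))
        + ennreal (affinity_on \<mu> \<mu>' (cyl (int n) (\<sigma> # w) \<inter> - C)) \<partial>count_space UNIV)"
  proof (intro nn_integral_mono)
    fix \<sigma>
    have "(1 - r / 2) * affinity_on \<mu> \<mu>' (cyl 0 (\<sigma> # w))
        \<le> affinity_on \<mu> \<mu>' (cyl (int n) (\<sigma> # w) \<inter> C) + affinity_on \<mu> \<mu>' (cyl (int n) (\<sigma> # w) \<inter> - C)"
      unfolding r_def
      by (rule Suc.IH) (use Suc.prems hk in \<open>auto simp: r_def add.commute add.left_commute\<close>)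
    then show "ennreal ((1 - r / 2) * affinity_on \<mu> \<mu>' (cyl 0 (\<sigma> # w)))
        \<le> ennreal (affinity_on \<mu> \<mu>' (cyl (int n) (\<sigma> # w) \<inter> C))
          + ennreal (affinity_on \<mu> \<mu>' (cyl (int n) (\<sigma> # w) \<inter> - C))"
      by (simp add: affinity_on_def ennreal_plus[symmetric] ennreal_leI del: ennreal_plus)
  qed
  also have "\<dots> \<le> ennreal (affinity_on \<mu> \<mu>' (cyl (int (Suc n)) w \<inter> C)) + ennreal (affinity_on \<mu> \<mu>' (cyl (int (Suc n)) w \<inter> - C))"
    by (simp add: nn_integral_add add_mono merge CM del: of_nat_Suc)
  finally have main: "(1 - r / 2) * ((1 - h k / 2) * affinity_on \<mu> \<mu>' (cyl 0 w))
      \<le> affinity_on \<mu> \<mu>' (cyl (int (Suc n)) w \<inter> C) + affinity_on \<mu> \<mu>' (cyl (int (Suc n)) w \<inter> - C)"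
    by (simp add: affinity_on_def ennreal_plus[symmetric] del: ennreal_plus)
  have "(1 - (h k + r) / 2) \<le> (1 - r / 2) * (1 - h k / 2)"
    using mult_nonneg_nonneg[OF r hk(1)] by (simp add: field_simps)
  then have "(1 - (h k + r) / 2) * affinity_on \<mu> \<mu>' (cyl 0 w) \<le> (1 - r / 2) * (1 - h k / 2) * affinity_on \<mu> \<mu>' (cyl 0 w)"
    by (rule mult_right_mono) (simp add: affinity_on_def)
  then show ?case using main by (simp only: sum_eq mult.assoc)
qed

section \<open>Local absolute continuity forces equality\<close>

text \<open>
  The countably many cylinders of words of length \<open>n\<close> cover the whole space.
\<close>

lemma exists_charged_word:
  fixes \<mu> :: "(int \<Rightarrow> 's::countable) measure"
  assumes "shift_invariant \<mu>"
  obtains w where "length w = n" "0 < measure \<mu> (cyl a w)"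
proof -
  interpret shift_invariant \<mu> by fact
  have "\<exists>w. length w = n \<and> cyl a w \<notin> null_sets \<mu>"
  proof (rule ccontr)
    assume "\<not> ?thesis"
    then have "(\<Union>w\<in>{w. length w = n}. cyl a w) \<in> null_sets \<mu>"
      by (intro null_sets_UN') auto
    moreover have "(\<Union>w\<in>{w. length w = n}. cyl a w) = (UNIV :: (int \<Rightarrow> 's) set)"
    proof (intro equalityI subsetI UNIV_I)
      fix x :: "int \<Rightarrow> 's"
      show "x \<in> (\<Union>w\<in>{w. length w = n}. cyl a w)"
        by (rule UN_I[of "map (\<lambda>i. x (a + int i)) [0..<n]"]) (simp_all add: cyl_def)
    qed
    ultimately show False using emeasure_space_1 by (auto simp: null_sets_def)
  qed
  then show ?thesis
    using that by (auto simp: null_sets_def emeasure_eq_measure zero_less_measure_iff)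
qed

text \<open>
  Local absolute continuity concerns the coordinates before 0; by invariance it applies to words
  at any position.
\<close>

lemma locally_ac_cyl:
  fixes \<nu> \<mu> :: "(int \<Rightarrow> 's::countable) measure"
  assumes "shift_invariant \<nu>" "shift_invariant \<mu>" "locally_ac \<nu> \<mu>" "measure \<mu> (cyl 0 w) = 0"
  shows "measure \<nu> (cyl 0 w) = 0"
proof -
  interpret M: shift_invariant \<mu> by fact
  interpret N: shift_invariant \<nu> by fact
  let ?n = "length w"
  let ?F = "coord_algebra {- int ?n..-1} :: (int \<Rightarrow> 's) measure"
  let ?B = "cyl (- int ?n) w"
  have shifted: "emeasure \<mu> ?B = emeasure \<mu> (cyl 0 w)" "emeasure \<nu> ?B = emeasure \<nu> (cyl 0 w)"
    using M.emeasure_cyl_shift[of "- int ?n" ?n w] N.emeasure_cyl_shift[of "- int ?n" ?n w] by simp_all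
  have sub: "subalgebra \<mu> ?F" "subalgebra \<nu> ?F"
    by (simp_all add: subalgebra_coord_algebra M.sets_borel N.sets_borel)
  have "?B \<in> sets ?F"
    by (rule cyl_coord_algebra) auto
  moreover have "?B \<in> null_sets \<mu>"
    using assms(4) shifted by (auto simp: null_sets_def M.emeasure_eq_measure)
  moreover have "null_sets \<mu> \<inter> sets ?F \<subseteq> null_sets \<nu>"
    using assms(3)[unfolded locally_ac_def absolutely_continuous_def, rule_format, of ?n]
    unfolding null_sets_restr_to_subalg[OF sub(1)] null_sets_restr_to_subalg[OF sub(2)] by blast
  ultimately have "?B \<in> null_sets \<nu>" by blast
  then show ?thesis using shifted by (simp add: null_sets_def N.emeasure_eq_measure)
qed

text \<open>
  The affinity of the word stays bounded below by \<open>affinity_lower_bound\<close>, so no set that depends on finitely many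
  coordinates can be nearly null for \<open>\<mu>'\<close> and nearly full for \<open>\<mu>\<close>. Mutually singular measures admit such sets.
\<close>

lemma g_measures_eq_if_common_word:
  fixes g :: "(nat \<Rightarrow> 's::countable) \<Rightarrow> real" and h :: "nat \<Rightarrow> real"
  assumes g: "g_function g" and \<mu>: "g_measure g \<mu>" "ergodic \<mu>" and \<mu>': "g_measure g \<mu>'" "ergodic \<mu>'"
    and h: "\<And>j. (svar (Suc j) (\<lambda>x. sqrt (g x)))\<^sup>2 \<le> ennreal (h j)" "\<And>j. 0 \<le> h j"
    and w: "length w = k + 2" and small: "\<And>n. (\<Sum>j<n. h (k + j)) \<le> 1"
    and pos: "0 < measure \<mu> (cyl 0 w)" "0 < measure \<mu>' (cyl 0 w)"
  shows "\<mu> = \<mu>'"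
proof (rule ccontr)
  assume neq: "\<mu> \<noteq> \<mu>'"
  have inv: "shift_invariant \<mu>" "shift_invariant \<mu>'"
    using \<mu> \<mu>' g_measure_shift_invariant by auto
  interpret M: shift_invariant \<mu> by (rule inv)
  interpret N: shift_invariant \<mu>' by (rule inv)
  have eq: "sets \<mu>' = sets \<mu>" by (simp add: M.sets_borel N.sets_borel)
  define c where "c = affinity_on \<mu> \<mu>' (cyl 0 w) / 2"
  have c: "0 < c" using pos by (simp add: c_def affinity_on_def)
  have bound: "c \<le> sqrt (measure \<mu>' C) + sqrt (measure \<mu> (- C))" if C: "C \<in> local_sets" for C
  proof -
    obtain n :: nat where n: "length w \<le> n" "determined_by {- int n..<int n} C" "C \<in> sets \<mu>"
    proof -
      obtain m :: nat where m: "determined_by {- int m..<int m} C" "C \<in> sets seq_borel"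
        using C by (auto simp: local_sets_def)
      have "determined_by {- int (max m (length w))..<int (max m (length w))} C"
        using m(1) by (rule determined_by_mono) auto
      then show ?thesis
        using that[of "max m (length w)"] m(2) by (simp add: M.sets_borel)
    qed
    \<comment> \<open>Move the window of \<open>C\<close> to \<open>[0, 2n)\<close>; the word \<open>w\<close> then occupies its last \<open>length w\<close> places.\<close>
    define D where "D = (shift ^^ n) -` C"
    define l where "l = 2 * n - length w"
    have l: "int l + int (length w) = 2 * int n" using n(1) by (simp add: l_def)
    have Ds: "D \<in> sets \<mu>" using M.vimage_funpow_shift(1)[OF n(3)] by (simp add: D_def)
    have "determined_by {0..<2 * int n} D"
      unfolding determined_by_def
    proof (intro allI impI)
      fix x y :: "int \<Rightarrow> 's" assume xy: "\<forall>i\<in>{0..<2 * int n}. x i = y i" "x \<in> D"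
      then have "\<forall>i\<in>{- int n..<int n}. (shift ^^ n) x i = (shift ^^ n) y i"
        by (auto simp: funpow_shift_apply)
      then show "y \<in> D" using n(2) xy(2) unfolding determined_by_def D_def by blast
    qed
    then have "(1 - (\<Sum>j<l. h (k + j)) / 2) * affinity_on \<mu> \<mu>' (cyl 0 w)
       \<le> affinity_on \<mu> \<mu>' (cyl (int l) w \<inter> D) + affinity_on \<mu> \<mu>' (cyl (int l) w \<inter> - D)"
      using small[of l] by (intro affinity_lower_bound[OF g \<mu>(1) \<mu>'(1) h Ds _ w]) (auto simp: l)
    moreover have "1/2 * affinity_on \<mu> \<mu>' (cyl 0 w) \<le> (1 - (\<Sum>j<l. h (k + j)) / 2) * affinity_on \<mu> \<mu>' (cyl 0 w)"
      using small[of l] by (intro mult_right_mono) (auto simp: affinity_on_def)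
    moreover have "affinity_on \<mu> \<mu>' (cyl (int l) w \<inter> D) \<le> sqrt (measure \<mu>' C)"
    proof -
      have "measure \<mu> (cyl (int l) w \<inter> D) * measure \<mu>' (cyl (int l) w \<inter> D) \<le> 1 * measure \<mu>' D"
        using Ds eq by (intro mult_mono N.finite_measure_mono) auto
      also have "measure \<mu>' D = measure \<mu>' C"
        using N.vimage_funpow_shift(2)[of C n] n(3) eq by (simp add: D_def measure_def)
      finally show ?thesis by (simp add: affinity_on_def)
    qed
    moreover have "affinity_on \<mu> \<mu>' (cyl (int l) w \<inter> - D) \<le> sqrt (measure \<mu> (- C))"
    proof -
      have nC: "- C \<in> sets \<mu>" using sets.compl_sets[OF n(3)] by (simp add: Compl_eq_Diff_UNIV)
      have nD: "- D = (shift ^^ n) -` (- C)" by (auto simp: D_def)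
      have "measure \<mu> (cyl (int l) w \<inter> - D) * measure \<mu>' (cyl (int l) w \<inter> - D) \<le> measure \<mu> (- D) * 1"
        using M.vimage_funpow_shift(1)[OF nC] nD by (intro mult_mono M.finite_measure_mono) auto
      also have "measure \<mu> (- D) = measure \<mu> (- C)"
        using M.vimage_funpow_shift(2)[OF nC, of n] nD by (simp add: measure_def)
      finally show ?thesis by (simp add: affinity_on_def)
    qed
    ultimately show ?thesis by (simp add: c_def)
  qed
  obtain A where A: "A \<in> sets \<mu>" "measure \<mu> A = 1" "measure \<mu>' A = 0"
    using ergodic_mutually_singular[OF inv \<mu>(2) \<mu>'(2) neq] .
  \<comment> \<open>This makes the bound for \<open>C\<close> at most \<open>2 * (c / 4)\<close>, less than \<open>c\<close>.\<close>
  define e where "e = (c / 4)\<^sup>2"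
  have e: "0 < e" using c by (simp add: e_def)
  obtain C where C: "C \<in> local_sets" "measure \<mu> (sym_diff A C) < e" "measure \<mu>' (sym_diff A C) < e"
    by (rule finite_measure_approx_by_algebra[OF M.finite_measure_axioms N.finite_measure_axioms
          algebra_local_sets _ _ A(1) e])
      (auto simp: M.sets_borel N.sets_borel sets_seq_borel_local_sets)
  have Cs: "C \<in> sets \<mu>" using C(1) by (simp add: local_sets_def M.sets_borel)
  have "measure \<mu>' C < e"
  proof -
    have "measure \<mu>' C \<le> measure \<mu>' (A \<union> sym_diff A C)"
      using A(1) Cs eq by (intro N.finite_measure_mono) auto
    also have "\<dots> \<le> measure \<mu>' A + measure \<mu>' (sym_diff A C)"
      using A(1) Cs eq by (intro measure_Un_le) auto
    finally show ?thesis using A(3) C(3) by simp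
  qed
  moreover have "measure \<mu> (- C) < e"
  proof -
    have U: "(space \<mu> - A) \<union> sym_diff A C \<in> sets \<mu>"
      using A(1) Cs by (intro sets.Un sets.Diff sets.top)
    have "measure \<mu> (- C) \<le> measure \<mu> ((space \<mu> - A) \<union> sym_diff A C)"
      using U by (intro M.finite_measure_mono) auto
    also have "\<dots> \<le> measure \<mu> (space \<mu> - A) + measure \<mu> (sym_diff A C)"
      using A(1) Cs by (intro measure_Un_le sets.Un sets.Diff sets.top)
    finally show ?thesis using A(2) C(2) M.prob_compl[OF A(1)] by simp
  qed
  ultimately have "sqrt (measure \<mu>' C) + sqrt (measure \<mu> (- C)) \<le> sqrt e + sqrt e"
    by (intro add_mono real_sqrt_le_mono) auto
  also have "\<dots> = c / 2" using c by (simp add: e_def)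
  finally show False using bound[OF C(1)] c by linarith
qed

text \<open>
  Summability gives a length from which on the remaining terms add up to at most 1, and local absolute
  continuity gives a word of this length that both measures charge.
\<close>

lemma not_locally_ac:
  fixes g :: "(nat \<Rightarrow> 's::countable) \<Rightarrow> real"
  assumes g: "g_function g"
    and sum: "(\<Sum>n. (svar (Suc n) (\<lambda>x. sqrt (g x)))\<^sup>2) < \<infinity>"
    and \<mu>: "g_measure g \<mu>" "ergodic \<mu>" and \<mu>': "g_measure g \<mu>'" "ergodic \<mu>'"
    and neq: "\<mu> \<noteq> \<mu>'"
  shows "\<not> locally_ac \<mu> \<mu>'"
proof
  assume ac: "locally_ac \<mu> \<mu>'"
  have inv: "shift_invariant \<mu>" "shift_invariant \<mu>'"
    using \<mu> \<mu>' g_measure_shift_invariant by auto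
  let ?s = "\<lambda>n. (svar (Suc n) (\<lambda>x. sqrt (g x)))\<^sup>2"
  define h where "h n = enn2real (?s n)" for n
  have "?s n < \<infinity>" for n
    using ennreal_suminf_lessD[of ?s] sum by auto
  then have h: "ennreal (h n) = ?s n" "0 \<le> h n" for n
    by (simp_all add: h_def)
  have "summable h"
  proof (rule summable_suminf_not_top)
    show "(\<Sum>n. ennreal (h n)) \<noteq> top" using sum by (simp add: h(1) less_top)
  qed (rule h(2))
  then obtain k where k: "\<And>n. norm (\<Sum>j\<in>{k..<n}. h j) < 1"
    unfolding summable_Cauchy by (meson order_refl zero_less_one)
  have small: "(\<Sum>j<n. h (k + j)) \<le> 1" for n
  proof -
    have "(\<Sum>j<n. h (k + j)) = (\<Sum>j\<in>{k..<k + n}. h j)"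
      using sum.shift_bounds_nat_ivl[of h 0 k n] by (simp add: add.commute atLeast0LessThan)
    then show ?thesis using k[of "k + n"] by simp
  qed
  obtain w where w: "length w = k + 2" "0 < measure \<mu> (cyl 0 w)"
    using exists_charged_word[OF inv(1)] .
  then have "0 < measure \<mu>' (cyl 0 w)"
    using locally_ac_cyl[OF inv ac, of w] by (auto simp: zero_less_measure_iff)
  then have "\<mu> = \<mu>'"
    by (intro g_measures_eq_if_common_word[OF g \<mu> \<mu>' _ h(2) w(1) small w(2)]) (simp_all add: h)
  then show False using neq by simp
qed

theorem theorem4p1:
  fixes g :: "(nat \<Rightarrow> 's::countable) \<Rightarrow> real"
    and \<mu> \<mu>' :: "(int \<Rightarrow> 's) measure"
  assumes "g_function g"
    and "(\<Sum>n. (svar (Suc n) (\<lambda>x. sqrt (g x)))\<^sup>2) < \<infinity>"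
    and "g_measure g \<mu>" and "ergodic \<mu>"
    and "g_measure g \<mu>'" and "ergodic \<mu>'"
    and "\<mu> \<noteq> \<mu>'"
  shows "\<not> locally_ac \<mu> \<mu>' \<and> \<not> locally_ac \<mu>' \<mu>"
  using not_locally_ac[OF assms(1,2)] assms(3-7) by metis

end
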